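(* Let $K$ be a number field with ring of integers $\mathcal{O}_K$, let $f\in\mathcal{O}_K[x,y]$ be a binary form of degree $d\ge2$, and let $\xi(f)=[\xi_0,\dots,\xi_n]\in\mathbb{WP}^n_{\mathbf w}(\mathcal{O}_K)$, with $\xi_i=\xi_i(f)$ and weights $\mathbf w=(q_0,\dots,q_n)$, be its moduli point (so the $\xi_i$ lie in $\mathcal{O}_K$ and are not all zero). Let $p\in\mathcal{O}_K$ be a prime. Then: (i) $f$ is semistable over $K_p$ if and only if $p\nmid\gcd(\xi_0,\dots,\xi_n)$. (ii) If $p\mid\gcd(\xi_0,\dots,\xi_n)$, let $$\alpha_p:=\min\{v_p(\xi_i)\;:\;0\le i\le n,\ \xi_i\neq0\},$$ let $j$ be an index with $\xi_j\ne0$ and $v_p(\xi_j)=\alpha_p$, and let $r_p=\dfrac{2\alpha_p}{d\,q_j}$. Then $f^M$ is semistable over $K_p$ for $$M=\begin{bmatrix}\dfrac1{p^{r_p}}&0\\0&1\end{bmatrix}\in\mathrm{GL}_2(\overline K).$$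
   Context: A binary form of degree $d$ is $f(x,y)=\sum_{i=0}^d a_ix^iy^{d-i}$. For $M=\begin{bmatrix}a&b\\c&d'\end{bmatrix}\in\mathrm{GL}_2$, $f^M(x,y)=f(ax+by,cx+d'y)$. The elements $\xi_0,\dots,\xi_n$ are a fixed minimal set of homogeneous generators, of degrees $q_0,\dots,q_n$ and chosen with integer coefficients, of the ring of $\mathrm{SL}_2$-invariants (polynomials in $a_0,\dots,a_d$) of binary forms of degree $d$; $\xi_i(f)$ is the value of $\xi_i$ at $f$. $\mathbb{WP}^n_{\mathbf w}$ is the weighted projective space, where $(x_0,\dots,x_n)\ne 0$ is identified with $(\lambda^{q_0}x_0,\dots,\lambda^{q_n}x_n)$ for nonzero $\lambda$. For a prime element $p\in\mathcal{O}_K$, $v_p$ denotes the exponent of $p$ (the $p$-adic valuation normalized by $v_p(p)=1$), extended to a fixed valuation on $\overline K$. Here $p^{r}$ for rational $r$ denotes a choice of $r$-th power of $p$ in $\overline K$, and $K_p$ is the completion of $K$ at $p$. "$p\mid\gcd(\xi_0,\dots,\xi_n)$" means that $p$ divides every $\xi_i$. A form $g$ (with the tuple $\xi_0(g),\dots,\xi_n(g)$) is called semistable over $K_p$ if some coordinate $\xi_i(g)$ is nonzero modulo $p$, i.e. $v_p(\xi_i(g))\le0$ for some $i$. *)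

theory Defs
  imports
    "HOL-Algebra.Algebraic_Closure_Type"
    "HOL-Analysis.Determinants"
    "HOL-Library.Extended_Real"
    "HOL-Library.Poly_Mapping"
begin

section \<open>Number fields, primes and valuations\<close>

class number_field = field_char_0 +
  assumes finite_over_rat:
    "\<exists>B. finite B \<and> (\<forall>x. \<exists>c :: 'a \<Rightarrow> rat. x = (\<Sum>b\<in>B. of_rat (c b) * b))"

instance rat :: number_field
proof
  show "\<exists>B. finite B \<and> (\<forall>x. \<exists>c :: rat \<Rightarrow> rat. x = (\<Sum>b\<in>B. of_rat (c b) * b))"
    by (rule exI[of _ "{1}"]) (auto intro: exI[of _ "\<lambda>_. _ :: rat"])
qed

definition ring_of_integers :: "'k :: number_field ring" where
  "ring_of_integers = ring_of_type_algebra \<lparr>carrier := {x. algebraic_int x}\<rparr>"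

text \<open>
  The exponent of a prime \<open>p\<close> in a nonzero algebraic integer. As the number field is the
  field of fractions of its ring of integers, a valuation of an extension field is an extension
  of \<open>v\<^sub>p\<close> if and only if it agrees with \<open>prime_exponent p\<close> on nonzero integers.
\<close>
definition prime_exponent :: "'k :: number_field \<Rightarrow> 'k \<Rightarrow> nat" where
  "prime_exponent p x = (GREATEST k. p ^ k divides\<^bsub>ring_of_integers\<^esub> x)"

definition is_valuation :: "('a :: field \<Rightarrow> ereal) \<Rightarrow> bool" where
  "is_valuation v \<longleftrightarrow>
     v 0 = \<infinity> \<and>
     (\<forall>x. x \<noteq> 0 \<longrightarrow> (\<exists>t :: real. v x = ereal t)) \<and>
     (\<forall>x y. v (x * y) = v x + v y) \<and>
     (\<forall>x y. min (v x) (v y) \<le> v (x + y))"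

definition extends_prime_valuation ::
    "'k :: number_field \<Rightarrow> ('k alg_closure \<Rightarrow> ereal) \<Rightarrow> bool" where
  "extends_prime_valuation p v \<longleftrightarrow>
     is_valuation v \<and>
     (\<forall>x \<in> carrier ring_of_integers. x \<noteq> 0 \<longrightarrow> v (to_ac x) = ereal (real (prime_exponent p x)))"

text \<open>\<open>y\<close> is some choice of \<open>x\<^sup>r\<close>; every representation of \<open>r\<close> as a fraction is admitted.\<close>
definition is_rat_power :: "rat \<Rightarrow> 'a :: field \<Rightarrow> 'a \<Rightarrow> bool" where
  "is_rat_power r x y \<longleftrightarrow>
     (\<exists>(a :: int) (b :: nat). b > 0 \<and> r = of_int a / of_nat b \<and> y ^ b = x powi a)"


section \<open>Binary forms\<close>

text \<open>
  A binary form \<open>\<Sum>i\<le>d. a\<^sub>i x\<^sup>i y\<^sup>d\<^sup>-\<^sup>i\<close> is represented by its coefficients; entries with index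
  greater than \<open>d\<close> are ignored.
\<close>
definition form_eval :: "nat \<Rightarrow> (nat \<Rightarrow> 'a :: comm_ring_1) \<Rightarrow> 'a \<Rightarrow> 'a \<Rightarrow> 'a" where
  "form_eval d f x y = (\<Sum>i\<le>d. f i * x ^ i * y ^ (d - i))"

text \<open>
  The coefficients of \<open>f\<^sup>M\<close>: the coefficient of \<open>x\<^sup>k y\<^sup>d\<^sup>-\<^sup>k\<close> in \<open>f (a x + b y, c x + d' y)\<close> is
  the coefficient of \<open>x\<^sup>k\<close> after setting \<open>y = 1\<close>. See the lemma \<open>form_eval_subst\<close> below.
\<close>
definition form_subst ::
    "nat \<Rightarrow> 'a :: comm_ring_1 ^ 2 ^ 2 \<Rightarrow> (nat \<Rightarrow> 'a) \<Rightarrow> nat \<Rightarrow> 'a" where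
  "form_subst d M f =
     Polynomial.coeff
       (\<Sum>i\<le>d. Polynomial.smult (f i)
          ([:M $ 1 $ 2, M $ 1 $ 1:] ^ i * [:M $ 2 $ 2, M $ 2 $ 1:] ^ (d - i)))"

lemma form_eval_coeff_linear_mult:
  fixes P :: "'a :: comm_ring_1 poly"
  assumes "Polynomial.degree P \<le> n"
  shows "form_eval (Suc n) (Polynomial.coeff ([:b, a:] * P)) x y =
         (a * x + b * y) * form_eval n (Polynomial.coeff P) x y"
proof -
  have top: "Polynomial.coeff P (Suc n) = 0"
    using assms by (simp add: coeff_eq_0)
  have "form_eval (Suc n) (Polynomial.coeff ([:b, a:] * P)) x y =
      (\<Sum>i\<le>Suc n. b * Polynomial.coeff P i * x ^ i * y ^ (Suc n - i)) +
      (\<Sum>i\<le>Suc n. Polynomial.coeff (pCons 0 (Polynomial.smult a P)) i * x ^ i * y ^ (Suc n - i))"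
    by (simp only: form_eval_def mult_pCons_left mult_zero_left pCons_0_0 add_0_right
        coeff_add coeff_smult distrib_right sum.distrib)
  also have "(\<Sum>i\<le>Suc n. b * Polynomial.coeff P i * x ^ i * y ^ (Suc n - i)) =
      b * y * form_eval n (Polynomial.coeff P) x y"
    by (auto simp: top form_eval_def sum_distrib_left Suc_diff_le mult_ac intro!: sum.cong)
  also have "(\<Sum>i\<le>Suc n. Polynomial.coeff (pCons 0 (Polynomial.smult a P)) i *
        x ^ i * y ^ (Suc n - i)) = a * x * form_eval n (Polynomial.coeff P) x y"
    by (subst sum.atMost_Suc_shift) (simp add: form_eval_def sum_distrib_left mult_ac)
  finally show ?thesis
    by (simp only: distrib_right add.commute)
qed

lemma degree_linear_power_mult:
  fixes P :: "'a :: comm_ring_1 poly"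
  assumes "Polynomial.degree P \<le> n"
  shows "Polynomial.degree ([:b, a:] ^ k * P) \<le> k + n"
proof (induction k)
  case (Suc k)
  have "Polynomial.degree ([:b, a:] * ([:b, a:] ^ k * P)) \<le>
        Polynomial.degree [:b, a:] + Polynomial.degree ([:b, a:] ^ k * P)"
    by (rule degree_mult_le)
  also have "\<dots> \<le> 1 + (k + n)"
    using Suc by (intro add_mono) auto
  finally show ?case
    by (simp add: mult.assoc del: mult_pCons_left)
qed (use assms in simp)

lemma form_eval_coeff_linear_power_mult:
  fixes P :: "'a :: comm_ring_1 poly"
  assumes "Polynomial.degree P \<le> n"
  shows "form_eval (k + n) (Polynomial.coeff ([:b, a:] ^ k * P)) x y =
         (a * x + b * y) ^ k * form_eval n (Polynomial.coeff P) x y"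
proof (induction k)
  case (Suc k)
  show ?case
    using form_eval_coeff_linear_mult[OF degree_linear_power_mult[OF assms, of b a k],
        of b a x y] Suc
    by (simp add: mult.assoc del: mult_pCons_left)
qed simp

lemma form_eval_subst:
  fixes M :: "'a :: comm_ring_1 ^ 2 ^ 2"
  shows "form_eval d (form_subst d M f) x y =
         form_eval d f (M $ 1 $ 1 * x + M $ 1 $ 2 * y) (M $ 2 $ 1 * x + M $ 2 $ 2 * y)"
proof -
  define P where "P = (\<lambda>i. [:M $ 1 $ 2, M $ 1 $ 1:] ^ i * [:M $ 2 $ 2, M $ 2 $ 1:] ^ (d - i))"
  have P: "form_eval d (Polynomial.coeff (P i)) x y =
      (M $ 1 $ 1 * x + M $ 1 $ 2 * y) ^ i * (M $ 2 $ 1 * x + M $ 2 $ 2 * y) ^ (d - i)"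
    if "i \<le> d" for i
  proof -
    have 1: "form_eval (d - i) (Polynomial.coeff ([:M $ 2 $ 2, M $ 2 $ 1:] ^ (d - i))) x y =
        (M $ 2 $ 1 * x + M $ 2 $ 2 * y) ^ (d - i)"
      using form_eval_coeff_linear_power_mult[of 1 0 "d - i" "M $ 2 $ 2" "M $ 2 $ 1" x y]
      by (simp add: form_eval_def)
    have "Polynomial.degree ([:M $ 2 $ 2, M $ 2 $ 1:] ^ (d - i)) \<le> d - i"
      using degree_linear_power_mult[of 1 0 "M $ 2 $ 2" "M $ 2 $ 1" "d - i"] by simp
    from form_eval_coeff_linear_power_mult[OF this, of i "M $ 1 $ 2" "M $ 1 $ 1" x y] 1 that
    show ?thesis by (simp add: P_def)
  qed
  have "form_eval d (form_subst d M f) x y =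
      (\<Sum>k\<le>d. \<Sum>i\<le>d. f i * (Polynomial.coeff (P i) k * x ^ k * y ^ (d - k)))"
    by (simp add: form_eval_def form_subst_def P_def coeff_sum sum_distrib_left sum_distrib_right mult_ac)
  also have "\<dots> = (\<Sum>i\<le>d. f i * form_eval d (Polynomial.coeff (P i)) x y)"
    by (subst sum.swap) (simp add: form_eval_def sum_distrib_left)
  also have "\<dots> = (\<Sum>i\<le>d. f i * ((M $ 1 $ 1 * x + M $ 1 $ 2 * y) ^ i *
      (M $ 2 $ 1 * x + M $ 2 $ 2 * y) ^ (d - i)))"
    by (intro sum.cong) (simp_all add: P)
  finally show ?thesis
    by (simp add: form_eval_def mult_ac)
qed


section \<open>Invariants of binary forms\<close>

text \<open>Polynomials in the variables \<open>a\<^sub>0, a\<^sub>1, \<dots>\<close>, which stand for the coefficients of a form.\<close>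
type_synonym 'a coeff_poly = "(nat \<Rightarrow>\<^sub>0 nat) \<Rightarrow>\<^sub>0 'a"

definition coeff_poly_eval :: "(nat \<Rightarrow> 'a :: comm_ring_1) \<Rightarrow> 'a coeff_poly \<Rightarrow> 'a" where
  "coeff_poly_eval a F =
     (\<Sum>m\<in>Poly_Mapping.keys F. Poly_Mapping.lookup F m *
        (\<Prod>i\<in>Poly_Mapping.keys m. a i ^ Poly_Mapping.lookup m i))"

definition of_int_poly :: "int coeff_poly \<Rightarrow> 'a :: comm_ring_1 coeff_poly" where
  "of_int_poly F = Poly_Mapping.map of_int F"

definition homogeneous_of_degree :: "nat \<Rightarrow> 'a :: zero coeff_poly \<Rightarrow> bool" where
  "homogeneous_of_degree q F \<longleftrightarrow>
     (\<forall>m\<in>Poly_Mapping.keys F. (\<Sum>i\<in>Poly_Mapping.keys m. Poly_Mapping.lookup m i) = q)"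

text \<open>
  Invariance is stated through the values of a polynomial, which is the same as invariance of the
  polynomial itself over an infinite field. The definition is only used over algebraically
  closed fields.
\<close>
definition SL2_invariants :: "nat \<Rightarrow> 'a :: field coeff_poly set" where
  "SL2_invariants d =
     {F. (\<forall>m\<in>Poly_Mapping.keys F. Poly_Mapping.keys m \<subseteq> {..d}) \<and>
         (\<forall>(M :: 'a ^ 2 ^ 2) f. det M = 1 \<longrightarrow>
            coeff_poly_eval (form_subst d M f) F = coeff_poly_eval f F)}"

inductive_set generated_algebra :: "'a :: comm_ring_1 coeff_poly set \<Rightarrow> 'a coeff_poly set"
  for S where
  const: "Poly_Mapping.single 0 c \<in> generated_algebra S"
| gen: "F \<in> S \<Longrightarrow> F \<in> generated_algebra S"
| add: "F \<in> generated_algebra S \<Longrightarrow> G \<in> generated_algebra S \<Longrightarrow> F + G \<in> generated_algebra S"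
| mult: "F \<in> generated_algebra S \<Longrightarrow> G \<in> generated_algebra S \<Longrightarrow> F * G \<in> generated_algebra S"

definition minimal_homogeneous_generators ::
    "nat \<Rightarrow> nat \<Rightarrow> (nat \<Rightarrow> nat) \<Rightarrow> (nat \<Rightarrow> 'a :: field coeff_poly) \<Rightarrow> bool" where
  "minimal_homogeneous_generators d n q F \<longleftrightarrow>
     inj_on F {..n} \<and>
     (\<forall>i\<le>n. homogeneous_of_degree (q i) (F i)) \<and>
     generated_algebra (F ` {..n}) = SL2_invariants d \<and>
     (\<forall>S. S \<subset> F ` {..n} \<longrightarrow> generated_algebra S \<noteq> SL2_invariants d)"

definition invariant_value :: "int coeff_poly \<Rightarrow> (nat \<Rightarrow> 'a :: comm_ring_1) \<Rightarrow> 'a" where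
  "invariant_value F f = coeff_poly_eval f (of_int_poly F)"

definition semistable ::
    "('a :: field \<Rightarrow> ereal) \<Rightarrow> nat \<Rightarrow> (nat \<Rightarrow> int coeff_poly) \<Rightarrow> (nat \<Rightarrow> 'a) \<Rightarrow> bool" where
  "semistable v n \<xi> g \<longleftrightarrow> (\<exists>i\<le>n. v (invariant_value (\<xi> i) g) \<le> 0)"

end

theory Submission
  imports "Jordan_Normal_Form.Char_Poly" Defs
begin

section \<open>Sums and products of algebraic integers\<close>

text \<open>On algebraic integers \<open>v\<close> is nonnegative, and it is positive exactly on the
  multiples of \<open>p\<close> (\<open>extends_prime_valuation_le_0_iff\<close>). The invariants of
  \<open>f\<close> are algebraic integers (\<open>algebraic_int_invariant_value\<close>), because
  algebraic integers are closed under sums and products; this gives (i).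

  For (ii), choose \<open>s\<close> in the algebraic closure with \<open>s ^ 2 = 1 / \<pi>\<close>.
  Then \<open>M\<close> is \<open>s\<close> times diag(s, 1/s), a matrix of determinant 1, so an
  invariant of degree q is multiplied by \<open>s ^ (d * q)\<close>
  (\<open>SL2_invariant_diagonal\<close>). Since \<open>v \<pi> = r\<close> for every choice of the
  power (\<open>is_valuation_rat_power\<close>), \<open>v s\<close> is -\<alpha>/(d q_j), and the
  coordinate with index \<open>j\<close> gets valuation -\<alpha> + \<alpha> = 0. The division by
  q_j is legitimate because a minimal system contains no generator of degree 0
  (\<open>minimal_homogeneous_generators_degree_pos\<close>).\<close>

lemma algebraic_int_if_stable_span:
  fixes z :: "'a :: field_char_0"
  assumes "finite B" and "b\<^sub>0 \<in> B" "b\<^sub>0 \<noteq> 0"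
    and stable: "\<And>b. b \<in> B \<Longrightarrow> \<exists>c :: 'a \<Rightarrow> int. z * b = (\<Sum>b'\<in>B. of_int (c b') * b')"
  shows "algebraic_int z"
proof -
  define n where "n = card B"
  obtain e where e: "bij_betw e {..<n} B"
    using ex_bij_betw_nat_finite[OF \<open>finite B\<close>] by (auto simp: n_def atLeast0LessThan)
  obtain c :: "'a \<Rightarrow> 'a \<Rightarrow> int" where
    c: "\<And>b. b \<in> B \<Longrightarrow> z * b = (\<Sum>b'\<in>B. of_int (c b b') * b')"
    using stable by metis
  define A where "A = Matrix.mat n n (\<lambda>(i, j). c (e i) (e j))"
  define w where "w = Matrix.vec n e"
  have A: "A \<in> carrier_mat n n"
    by (simp add: A_def)
  have "vec_index (map_mat of_int A *\<^sub>v w) i = vec_index (z \<cdot>\<^sub>v w) i" if "i < n" for i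
  proof -
    have "vec_index (map_mat of_int A *\<^sub>v w) i = (\<Sum>j<n. of_int (c (e i) (e j)) * e j)"
      using that by (simp add: A_def w_def scalar_prod_def atLeast0LessThan)
    also have "\<dots> = (\<Sum>b\<in>B. of_int (c (e i) b) * b)"
      by (rule sum.reindex_bij_betw[OF e])
    also have "\<dots> = z * e i"
      using that e by (subst c) (auto simp: bij_betw_def)
    finally show ?thesis
      using that by (simp add: w_def)
  qed
  hence "map_mat of_int A *\<^sub>v w = z \<cdot>\<^sub>v w"
    by (intro eq_vecI) (auto simp: A_def w_def)
  moreover have "w \<noteq> 0\<^sub>v n"
  proof -
    obtain i where "i < n" "e i = b\<^sub>0"
      using e \<open>b\<^sub>0 \<in> B\<close> unfolding bij_betw_def by blast
    hence "vec_index w i \<noteq> vec_index (0\<^sub>v n) i"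
      using \<open>b\<^sub>0 \<noteq> 0\<close> by (simp add: w_def)
    thus ?thesis by metis
  qed
  ultimately have "eigenvalue (map_mat of_int A) z"
    unfolding eigenvalue_def eigenvector_def by (intro exI[of _ w]) (auto simp: A_def w_def)
  hence "Polynomial.poly (char_poly (map_mat of_int A)) z = 0"
    using A by (subst (asm) eigenvalue_root_char_poly[of _ n]) auto
  hence "Polynomial.poly (map_poly of_int (char_poly A)) z = 0"
    by (simp add: of_int_hom.char_poly_hom[OF A])
  moreover have "Polynomial.lead_coeff (char_poly A) = 1"
    using degree_monic_char_poly[OF A] by auto
  ultimately show ?thesis
    by (auto simp: algebraic_int_altdef_ipoly)
qed

text \<open>With integers acting through \<open>of_int\<close>, \<open>int_module.span B\<close> is
  the additive subgroup generated by \<open>B\<close>.\<close>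

interpretation int_module: Modules.module "\<lambda>(k :: int) (x :: 'a :: comm_ring_1). of_int k * x"
  by unfold_locales (simp_all add: algebra_simps)

text \<open>Multiplication by \<open>z\<close> is additive, so stability of a span has to be tested
  only on its generators.\<close>

lemma mult_in_int_span:
  assumes "x \<in> int_module.span B" and "\<And>b. b \<in> B \<Longrightarrow> z * b \<in> int_module.span B"
  shows "z * x \<in> int_module.span B"
  using assms(1)
proof (induction rule: int_module.span_induct_alt)
  case (step c x y)
  have "z * (of_int c * x + y) = of_int c * (z * x) + z * y"
    by (simp add: algebra_simps)
  with step assms(2) show ?case
    by (simp add: int_module.span_add int_module.span_scale)
qed (simp add: int_module.span_zero)

text \<open>The monic equation of \<open>x\<close> is solved for its leading power. The free factor
  \<open>y\<close> later becomes a power of a second algebraic integer.\<close>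

lemma algebraic_int_power_in_span:
  fixes x :: "'a :: field_char_0"
  assumes "algebraic_int x"
  obtains m where "m > 0" and "\<And>y. x ^ m * y \<in> int_module.span ((\<lambda>i. x ^ i * y) ` {..<m})"
proof -
  obtain P where P: "Polynomial.poly (map_poly of_int P) x = 0" "Polynomial.lead_coeff P = 1"
    using assms by (auto simp: algebraic_int_altdef_ipoly)
  define m where "m = Polynomial.degree P"
  \<comment> \<open>A monic constant is 1 and has no root.\<close>
  have "m > 0"
  proof (rule ccontr)
    assume "\<not> m > 0"
    then obtain c where "P = [:c:]"
      by (auto simp: m_def elim: degree_eq_zeroE)
    with P show False by simp
  qed
  moreover have "x ^ m * y \<in> int_module.span ((\<lambda>i. x ^ i * y) ` {..<m})" for y
  proof -
    have "0 = (\<Sum>i\<le>m. of_int (Polynomial.coeff P i) * x ^ i)"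
      using P(1) by (simp add: poly_altdef m_def)
    also have "\<dots> = (\<Sum>i<m. of_int (Polynomial.coeff P i) * x ^ i) + x ^ m"
      using P(2) by (simp add: m_def flip: lessThan_Suc_atMost)
    finally have "x ^ m = - (\<Sum>i<m. of_int (Polynomial.coeff P i) * x ^ i)"
      by (simp add: eq_neg_iff_add_eq_0 add.commute)
    hence "x ^ m * y = - (\<Sum>i<m. of_int (Polynomial.coeff P i) * (x ^ i * y))"
      by (simp add: sum_distrib_right mult.assoc)
    also have "\<dots> \<in> int_module.span ((\<lambda>i. x ^ i * y) ` {..<m})"
      by (intro int_module.span_neg int_module.span_sum int_module.span_scale
          int_module.span_base) auto
    finally show ?thesis .
  qed
  ultimately show ?thesis
    using that by blast
qed

text \<open>
  The monomials \<open>x\<^sup>i y\<^sup>j\<close> below the degrees of the monic equations of \<open>x\<close> and \<open>y\<close> span a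
  \<open>\<int>\<close>-module that is stable under multiplication by \<open>x\<close> and by \<open>y\<close>.
\<close>
lemma algebraic_int_common_stable_span:
  fixes x y :: "'a :: field_char_0"
  assumes "algebraic_int x" "algebraic_int y"
  obtains B where "finite B" "1 \<in> B"
    and "\<And>b. b \<in> B \<Longrightarrow> x * b \<in> int_module.span B"
    and "\<And>b. b \<in> B \<Longrightarrow> y * b \<in> int_module.span B"
proof -
  obtain m where m: "m > 0" "\<And>y. x ^ m * y \<in> int_module.span ((\<lambda>i. x ^ i * y) ` {..<m})"
    using algebraic_int_power_in_span[OF assms(1)] by metis
  obtain n where n: "n > 0" "\<And>x. y ^ n * x \<in> int_module.span ((\<lambda>i. y ^ i * x) ` {..<n})"
    using algebraic_int_power_in_span[OF assms(2)] by metis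
  define B where "B = (\<lambda>(i, j). x ^ i * y ^ j) ` ({..<m} \<times> {..<n})"
  show ?thesis
  proof
    show "finite B" by (simp add: B_def)
    show "1 \<in> B"
      unfolding B_def using m(1) n(1) by (intro image_eqI[of _ _ "(0, 0)"]) auto
  next
    fix b assume "b \<in> B"
    then obtain i j where ij: "i < m" "j < n" "b = x ^ i * y ^ j"
      by (auto simp: B_def)
    show "x * b \<in> int_module.span B"
    proof (cases "Suc i < m")
      case True
      thus ?thesis
        using ij by (intro int_module.span_base) (auto simp: B_def intro!: image_eqI[of _ _ "(Suc i, j)"])
    next
      case False
      hence "Suc i = m" using ij by simp
      \<comment> \<open>Only at the top exponent does multiplication leave \<open>B\<close>; there
        the monic equation leads back into its span.\<close>
      hence "x * b = x ^ m * y ^ j"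
        using ij by auto
      moreover have "(\<lambda>i. x ^ i * y ^ j) ` {..<m} \<subseteq> B"
        using ij by (auto simp: B_def)
      ultimately show ?thesis
        using m(2)[of "y ^ j"] subsetD[OF int_module.span_mono] by simp
    qed
    show "y * b \<in> int_module.span B"
    proof (cases "Suc j < n")
      case True
      thus ?thesis
        using ij by (intro int_module.span_base) (auto simp: B_def intro!: image_eqI[of _ _ "(i, Suc j)"])
    next
      case False
      hence "Suc j = n" using ij by simp
      hence "y * b = y ^ n * x ^ i"
        using ij by (auto simp: mult_ac)
      moreover have "(\<lambda>j. y ^ j * x ^ i) ` {..<n} \<subseteq> B"
        using ij by (auto simp: B_def mult.commute)
      ultimately show ?thesis
        using n(2)[of "x ^ i"] subsetD[OF int_module.span_mono] by simp
    qed
  qed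
qed

text \<open>Multiplication by \<open>x\<close> and by \<open>y\<close> preserves one common finitely
  generated module containing 1, hence so does multiplication by their sum and by their
  product.\<close>

lemma
  fixes x y :: "'a :: field_char_0"
  assumes "algebraic_int x" "algebraic_int y"
  shows algebraic_int_add: "algebraic_int (x + y)"
    and algebraic_int_mult: "algebraic_int (x * y)"
proof -
  obtain B where B: "finite B" "1 \<in> B"
    and x: "\<And>b. b \<in> B \<Longrightarrow> x * b \<in> int_module.span B"
    and y: "\<And>b. b \<in> B \<Longrightarrow> y * b \<in> int_module.span B"
    using algebraic_int_common_stable_span[OF assms] by metis
  have *: "algebraic_int z" if "\<And>b. b \<in> B \<Longrightarrow> z * b \<in> int_module.span B" for z
    using that B
    by (intro algebraic_int_if_stable_span[of B 1]) (auto simp: int_module.span_finite)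
  show "algebraic_int (x + y)"
    using x y by (intro *) (simp add: distrib_right int_module.span_add)
  show "algebraic_int (x * y)"
    using mult_in_int_span[OF y x] by (intro *) (simp add: mult.assoc)
qed

lemma algebraic_int_sum:
  fixes g :: "'b \<Rightarrow> 'a :: field_char_0"
  shows "(\<And>i. i \<in> A \<Longrightarrow> algebraic_int (g i)) \<Longrightarrow> algebraic_int (\<Sum>i\<in>A. g i)"
  by (induction A rule: infinite_finite_induct) (auto intro: algebraic_int_add)

lemma algebraic_int_prod:
  fixes g :: "'b \<Rightarrow> 'a :: field_char_0"
  shows "(\<And>i. i \<in> A \<Longrightarrow> algebraic_int (g i)) \<Longrightarrow> algebraic_int (\<Prod>i\<in>A. g i)"
  by (induction A rule: infinite_finite_induct) (auto intro: algebraic_int_mult)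

lemma algebraic_int_power:
  fixes x :: "'a :: field_char_0"
  shows "algebraic_int x \<Longrightarrow> algebraic_int (x ^ n)"
  by (induction n) (auto intro: algebraic_int_mult)


section \<open>The prime exponent and the valuation\<close>

lemma carrier_ring_of_integers [simp]: "x \<in> carrier ring_of_integers \<longleftrightarrow> algebraic_int x"
  by (simp add: ring_of_integers_def ring_of_type_algebra_def)

lemma divides_ring_of_integers:
  "a divides\<^bsub>ring_of_integers\<^esub> b \<longleftrightarrow> (\<exists>c. algebraic_int c \<and> b = a * c)"
  by (auto simp: factor_def ring_of_integers_def ring_of_type_algebra_def)

lemma ring_prime_ring_of_integersD:
  assumes "algebraic_int p" "ring_prime\<^bsub>ring_of_integers\<^esub> p"
  shows "p \<noteq> 0" and "\<not> p divides\<^bsub>ring_of_integers\<^esub> 1"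
  using assms
  by (auto simp: ring_prime_def prime_def Units_def divides_ring_of_integers
      ring_of_integers_def ring_of_type_algebra_def mult.commute)

text \<open>If \<open>p ^ k\<close> divided \<open>p\<close> for some k > 1, cancelling
  \<open>p\<close> would make it a unit. This gives the normalization v(p) = 1.\<close>

lemma prime_exponent_self:
  assumes "algebraic_int p" "p \<noteq> 0" "\<not> p divides\<^bsub>ring_of_integers\<^esub> 1"
  shows "prime_exponent p p = 1"
  unfolding prime_exponent_def
proof (rule Greatest_equality)
  show "p ^ 1 divides\<^bsub>ring_of_integers\<^esub> p"
    unfolding divides_ring_of_integers by (intro exI[of _ 1]) auto
next
  fix k assume "p ^ k divides\<^bsub>ring_of_integers\<^esub> p"
  then obtain c where c: "algebraic_int c" "p = p ^ k * c"
    by (auto simp: divides_ring_of_integers)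
  show "k \<le> 1"
  proof (rule ccontr)
    assume "\<not> k \<le> 1"
    then obtain j where "k = Suc (Suc j)"
      by (metis One_nat_def Suc_le_mono le0 not0_implies_Suc)
    with c \<open>p \<noteq> 0\<close> have "1 = p * (p ^ j * c)"
      by (simp add: mult.assoc)
    moreover have "algebraic_int (p ^ j * c)"
      using assms(1) c(1) by (intro algebraic_int_mult algebraic_int_power)
    ultimately show False
      using assms(3) by (auto simp: divides_ring_of_integers)
  qed
qed

lemma prime_exponent_eq_0:
  assumes "algebraic_int p" "algebraic_int x" "\<not> p divides\<^bsub>ring_of_integers\<^esub> x"
  shows "prime_exponent p x = 0"
  unfolding prime_exponent_def
proof (rule Greatest_equality)
  show "p ^ 0 divides\<^bsub>ring_of_integers\<^esub> x"
    using assms(2) by (auto simp: divides_ring_of_integers)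
next
  fix k assume "p ^ k divides\<^bsub>ring_of_integers\<^esub> x"
  then obtain c where c: "algebraic_int c" "x = p ^ k * c"
    by (auto simp: divides_ring_of_integers)
  show "k \<le> 0"
  proof (rule ccontr)
    assume "\<not> k \<le> 0"
    then obtain j where "k = Suc j"
      by (cases k) auto
    with c have "x = p * (p ^ j * c)"
      by (simp add: mult.assoc)
    moreover have "algebraic_int (p ^ j * c)"
      using assms(1) c(1) by (intro algebraic_int_mult algebraic_int_power)
    ultimately show False
      using assms(3) by (auto simp: divides_ring_of_integers)
  qed
qed

section \<open>Arithmetic of valuations\<close>

lemma is_valuation_mult: "is_valuation v \<Longrightarrow> v (x * y) = v x + v y"
  by (simp add: is_valuation_def)

lemma is_valuation_finite:
  assumes "is_valuation v" "x \<noteq> 0"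
  obtains t where "v x = ereal t"
  using assms by (auto simp: is_valuation_def)

text \<open>From 1 * 1 = 1 one gets v(1) = 2 v(1), and v(1) can be cancelled because it is
  finite.\<close>

lemma is_valuation_1:
  assumes "is_valuation v"
  shows "v 1 = 0"
proof -
  obtain t where "v 1 = ereal t"
    using is_valuation_finite[OF assms] one_neq_zero by blast
  with is_valuation_mult[OF assms, of 1 1] show ?thesis
    by (simp add: zero_ereal_def)
qed

lemma is_valuation_power:
  assumes "is_valuation v" "v x = ereal t"
  shows "v (x ^ n) = ereal (real n * t)"
  by (induction n)
    (use assms in \<open>simp_all add: is_valuation_1 is_valuation_mult zero_ereal_def algebra_simps\<close>)

lemma is_valuation_inverse:
  assumes "is_valuation v" "v x = ereal t" "x \<noteq> 0"
  shows "v (inverse x) = ereal (- t)"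
proof -
  obtain s where "v (inverse x) = ereal s"
    using is_valuation_finite[OF assms(1)] assms(3) by (metis inverse_nonzero_iff_nonzero)
  moreover have "v (x * inverse x) = 0"
    using assms(1,3) by (simp add: is_valuation_1)
  ultimately show ?thesis
    using assms(1,2) by (simp add: is_valuation_mult zero_ereal_def)
qed

lemma is_valuation_powi:
  assumes "is_valuation v" "v x = ereal t" "x \<noteq> 0"
  shows "v (x powi k) = ereal (of_int k * t)"
proof (cases "k \<ge> 0")
  case True
  thus ?thesis
    using is_valuation_power[OF assms(1,2), of "nat k"] by (simp add: power_int_def)
next
  case False
  thus ?thesis
    using is_valuation_power[OF assms(1) is_valuation_inverse[OF assms], of "nat (- k)"]
    by (simp add: power_int_def)
qed

text \<open>Applying \<open>v\<close> to \<open>y ^ b = x powi a\<close> gives b v(y) = a v(x), so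
  the valuation depends neither on the chosen root nor on the fraction representing
  \<open>r\<close>.\<close>

lemma is_valuation_rat_power:
  assumes "is_valuation v" "v x = ereal t" "x \<noteq> 0" "is_rat_power r x y"
  shows "y \<noteq> 0" and "v y = ereal (of_rat r * t)"
proof -
  obtain a :: int and b :: nat where ab: "b > 0" "r = of_int a / of_nat b" "y ^ b = x powi a"
    using assms(4) by (auto simp: is_rat_power_def)
  show "y \<noteq> 0"
  proof
    assume "y = 0"
    with ab have "x powi a = 0" by (simp add: zero_power flip: ab(3))
    thus False using assms(3) by (simp add: power_int_eq_0_iff)
  qed
  then obtain s where s: "v y = ereal s"
    using is_valuation_finite[OF assms(1)] by blast
  have "real b * s = of_int a * t"
    using is_valuation_power[OF assms(1) s, of b] is_valuation_powi[OF assms(1,2,3), of a] ab(3)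
    by simp
  also have "of_int a = real b * of_rat r"
    using ab(1) by (simp add: ab(2) of_rat_divide)
  finally show "v y = ereal (of_rat r * t)"
    using ab(1) s by simp
qed

text \<open>
  That \<open>v\<close> is positive on the multiples of \<open>p\<close> needs no bound on their \<open>p\<close>-adic exponents: it follows
  from multiplicativity and \<open>v p = 1\<close>. So the \<open>GREATEST\<close> in \<open>prime_exponent\<close> is
  evaluated only at \<open>p\<close> and at integers prime to \<open>p\<close>.
\<close>
lemma extends_prime_valuation_le_0_iff:
  assumes "algebraic_int p" "ring_prime\<^bsub>ring_of_integers\<^esub> p"
    and v: "extends_prime_valuation p v" and x: "algebraic_int x"
  shows "v (to_ac x) \<le> 0 \<longleftrightarrow> \<not> p divides\<^bsub>ring_of_integers\<^esub> x"
proof -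
  note p = ring_prime_ring_of_integersD[OF assms(1,2)]
  have val: "is_valuation v"
    and ext: "\<And>y. algebraic_int y \<Longrightarrow> y \<noteq> 0 \<Longrightarrow> v (to_ac y) = ereal (real (prime_exponent p y))"
    using v by (auto simp: extends_prime_valuation_def)
  have 0: "v 0 = \<infinity>"
    using val by (simp add: is_valuation_def)
  have vp: "v (to_ac p) = 1"
    using ext[OF assms(1) p(1)] prime_exponent_self[OF assms(1) p] by simp
  show ?thesis
  proof (cases "p divides\<^bsub>ring_of_integers\<^esub> x")
    case True
    then obtain c where c: "algebraic_int c" "x = p * c"
      by (auto simp: divides_ring_of_integers)
    have "v (to_ac c) \<ge> 0"
      using ext[OF c(1)] 0 by (cases "c = 0") auto
    hence "v (to_ac x) \<ge> 1 + 0"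
      unfolding c(2) to_ac_mult is_valuation_mult[OF val] vp by (intro add_left_mono)
    hence "\<not> v (to_ac x) \<le> 0"
      using order_trans[of 1 "v (to_ac x)" 0] by auto
    with True show ?thesis by simp
  next
    case False
    moreover have "x \<noteq> 0"
      using False by (auto simp: divides_ring_of_integers)
    ultimately show ?thesis
      using ext[OF x] prime_exponent_eq_0[OF assms(1) x] by simp
  qed
qed


section \<open>Values of invariants\<close>

text \<open>In characteristic 0 no nonzero integer coefficient is mapped to 0.\<close>

lemma keys_of_int_poly [simp]:
  "Poly_Mapping.keys (of_int_poly F :: 'a :: {comm_ring_1, ring_char_0} coeff_poly) =
     Poly_Mapping.keys F"
  by (auto simp: of_int_poly_def in_keys_iff Poly_Mapping.map.rep_eq when_def)

lemma lookup_of_int_poly [simp]: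
  "Poly_Mapping.lookup (of_int_poly F) m = of_int (Poly_Mapping.lookup F m)"
  by (simp add: of_int_poly_def Poly_Mapping.map.rep_eq when_def)

lemma to_ac_invariant_value:
  fixes f :: "nat \<Rightarrow> 'k :: field_char_0"
  shows "invariant_value F (\<lambda>i. to_ac (f i)) = to_ac (invariant_value F f)"
  by (simp add: invariant_value_def coeff_poly_eval_def to_ac_sum to_ac_prod)

text \<open>The bound on the variables keeps out the entries of \<open>f\<close> beyond
  \<open>d\<close>, which may fail to be integral.\<close>

lemma algebraic_int_invariant_value:
  fixes f :: "nat \<Rightarrow> 'k :: field_char_0"
  assumes "\<forall>m\<in>Poly_Mapping.keys F. Poly_Mapping.keys m \<subseteq> {..d}" "\<forall>i\<le>d. algebraic_int (f i)"
  shows "algebraic_int (invariant_value F f)"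
  unfolding invariant_value_def coeff_poly_eval_def keys_of_int_poly lookup_of_int_poly
  using assms
  by (intro algebraic_int_sum algebraic_int_mult algebraic_int_prod algebraic_int_power) auto

section \<open>Homogeneity and diagonal substitutions\<close>

lemma coeff_poly_eval_scale:
  assumes "homogeneous_of_degree q F"
  shows "coeff_poly_eval (\<lambda>k. c * g k) F = c ^ q * coeff_poly_eval g F"
proof -
  have "(\<Prod>i\<in>Poly_Mapping.keys m. (c * g i) ^ Poly_Mapping.lookup m i) =
      c ^ q * (\<Prod>i\<in>Poly_Mapping.keys m. g i ^ Poly_Mapping.lookup m i)"
    if "m \<in> Poly_Mapping.keys F" for m
    using assms that
    by (auto simp: power_mult_distrib prod.distrib homogeneous_of_degree_def simp flip: power_sum)
  thus ?thesis
    by (simp add: coeff_poly_eval_def sum_distrib_left mult_ac)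
qed

text \<open>Both linear forms are monomials, so each coefficient of \<open>f\<close> contributes to
  a single coefficient of the result.\<close>

lemma form_subst_diagonal:
  fixes a b :: "'a :: comm_ring_1"
  shows "form_subst d (vector [vector [a, 0], vector [0, b]]) f k =
     (if k \<le> d then f k * (a ^ k * b ^ (d - k)) else 0)"
proof -
  have "[:0, a:] ^ i * [:b, 0:] ^ j = Polynomial.monom (a ^ i * b ^ j) i" for i j
  proof -
    have "[:0, a:] = Polynomial.monom a 1" "[:b, 0:] = Polynomial.monom b 0"
      by (simp_all add: monom_Suc monom_0)
    thus ?thesis
      by (simp only: monom_power mult_monom) simp
  qed
  thus ?thesis
    by (simp add: form_subst_def vector_2 coeff_sum smult_monom if_distrib
        cong: if_cong)
qed

section \<open>Positivity of the degrees of the generators\<close>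

lemma generated_algebra_remove_const:
  assumes "Poly_Mapping.single 0 c \<in> S"
  shows "generated_algebra (S - {Poly_Mapping.single 0 c}) = generated_algebra S"
proof (intro subset_antisym subsetI)
  fix F assume "F \<in> generated_algebra (S - {Poly_Mapping.single 0 c})"
  thus "F \<in> generated_algebra S"
    by induction (auto intro: generated_algebra.intros)
next
  fix F assume "F \<in> generated_algebra S"
  thus "F \<in> generated_algebra (S - {Poly_Mapping.single 0 c})"
  proof induction
    case (gen F)
    thus ?case
      by (cases "F = Poly_Mapping.single 0 c") (auto intro: generated_algebra.intros)
  qed (auto intro: generated_algebra.intros)
qed

lemma homogeneous_of_degree_0:
  assumes "homogeneous_of_degree 0 F"
  shows "F = Poly_Mapping.single 0 (Poly_Mapping.lookup F 0)"
proof -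
  have "m = 0" if "m \<in> Poly_Mapping.keys F" for m
  proof -
    have "(\<Sum>i\<in>Poly_Mapping.keys m. Poly_Mapping.lookup m i) = 0"
      using assms that by (auto simp: homogeneous_of_degree_def)
    thus ?thesis
      by (intro poly_mapping_eqI) (auto simp: in_keys_iff)
  qed
  thus ?thesis
    by (intro poly_mapping_eqI) (auto simp: lookup_single when_def in_keys_iff)
qed

text \<open>A generator of degree 0 is a constant, and constants lie in every generated algebra, so
  dropping it would contradict minimality.\<close>

lemma minimal_homogeneous_generators_degree_pos:
  assumes "minimal_homogeneous_generators d n q F" "j \<le> n"
  shows "q j > 0"
proof (rule ccontr)
  assume "\<not> q j > 0"
  hence "F j = Poly_Mapping.single 0 (Poly_Mapping.lookup (F j) 0)"
    using assms by (intro homogeneous_of_degree_0) (auto simp: minimal_homogeneous_generators_def)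
  hence "generated_algebra (F ` {..n} - {F j}) = generated_algebra (F ` {..n})"
    using assms(2) by (metis generated_algebra_remove_const atMost_iff imageI)
  moreover have "F ` {..n} - {F j} \<subset> F ` {..n}"
    using assms(2) by auto
  ultimately show False
    using assms(1) by (auto simp: minimal_homogeneous_generators_def)
qed

text \<open>\<open>diag(s\<^sup>2, 1)\<close> is \<open>s\<close> times \<open>diag(s, 1/s)\<close>, and the latter has determinant 1.\<close>
lemma SL2_invariant_diagonal:
  fixes s :: "'a :: field"
  assumes "F \<in> SL2_invariants d" "homogeneous_of_degree q F" "s \<noteq> 0"
  shows "coeff_poly_eval (form_subst d (vector [vector [s ^ 2, 0], vector [0, 1]]) g) F =
           s ^ (d * q) * coeff_poly_eval g F"
proof -
  define N :: "'a ^ 2 ^ 2" where "N = vector [vector [s, 0], vector [0, 1 / s]]"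
  have "form_subst d (vector [vector [s ^ 2, 0], vector [0, 1]]) g k = s ^ d * form_subst d N g k" for k
  proof (cases "k \<le> d")
    case True
    \<comment> \<open>\<open>N\<close> multiplies coefficient \<open>k\<close> by s^k / s^(d-k); the
      factor \<open>s ^ d\<close> turns this into s^(2k), as required for diag(s^2, 1).\<close>
    hence "s ^ d = s ^ k * s ^ (d - k)"
      by (simp flip: power_add)
    with True assms(3) show ?thesis
      by (simp add: N_def form_subst_diagonal power_divide flip: power_mult)
        (simp add: mult_2_right power_add mult_ac power2_eq_square)
  qed (simp add: N_def form_subst_diagonal)
  hence "coeff_poly_eval (form_subst d (vector [vector [s ^ 2, 0], vector [0, 1]]) g) F =
      (s ^ d) ^ q * coeff_poly_eval (form_subst d N g) F"
    using coeff_poly_eval_scale[OF assms(2), of "s ^ d" "form_subst d N g"] by presburger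
  also have "Determinants.det N = 1"
    using assms(3) by (simp add: N_def det_2)
  hence "coeff_poly_eval (form_subst d N g) F = coeff_poly_eval g F"
    using assms(1) by (simp add: SL2_invariants_def)
  finally show ?thesis
    by (simp add: power_mult)
qed

theorem lemma6:
  fixes d n :: nat
    and q :: "nat \<Rightarrow> nat"
    and \<xi> :: "nat \<Rightarrow> int coeff_poly"
    and f :: "nat \<Rightarrow> 'k :: number_field"
    and p :: 'k
    and v :: "'k alg_closure \<Rightarrow> ereal"
  assumes "d \<ge> 2"
    and generators: "minimal_homogeneous_generators d n q
           (\<lambda>i. of_int_poly (\<xi> i) :: 'k alg_closure coeff_poly)"
    and form: "\<forall>i\<le>d. f i \<in> carrier ring_of_integers"
    and moduli_point: "\<exists>i\<le>n. invariant_value (\<xi> i) f \<noteq> 0"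
    and prime_p: "p \<in> carrier ring_of_integers" "ring_prime\<^bsub>ring_of_integers\<^esub> p"
    and valuation: "extends_prime_valuation p v"
  shows "(semistable v n \<xi> (\<lambda>i. to_ac (f i)) \<longleftrightarrow>
            \<not> (\<forall>i\<le>n. p divides\<^bsub>ring_of_integers\<^esub> invariant_value (\<xi> i) f)) \<and>
         ((\<forall>i\<le>n. p divides\<^bsub>ring_of_integers\<^esub> invariant_value (\<xi> i) f) \<longrightarrow>
            (\<forall>(\<alpha> :: nat) j (r :: rat) (\<pi> :: 'k alg_closure) (M :: 'k alg_closure ^ 2 ^ 2).
               \<alpha> = Min {prime_exponent p (invariant_value (\<xi> i) f) | i.
                         i \<le> n \<and> invariant_value (\<xi> i) f \<noteq> 0} \<and>
               j \<le> n \<and> invariant_value (\<xi> j) f \<noteq> 0 \<and>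
               prime_exponent p (invariant_value (\<xi> j) f) = \<alpha> \<and>
               r = 2 * of_nat \<alpha> / (of_nat d * of_nat (q j)) \<and>
               is_rat_power r (to_ac p) \<pi> \<and>
               M = vector [vector [1 / \<pi>, 0], vector [0, 1]] \<longrightarrow>
               invertible M \<and> semistable v n \<xi> (form_subst d M (\<lambda>i. to_ac (f i)))))"
proof -
  let ?F = "\<lambda>i. of_int_poly (\<xi> i) :: 'k alg_closure coeff_poly"
  have p: "algebraic_int p"
    using prime_p(1) by simp
  have val: "is_valuation v"
    and ext: "\<And>y. algebraic_int y \<Longrightarrow> y \<noteq> 0 \<Longrightarrow> v (to_ac y) = ereal (real (prime_exponent p y))"
    using valuation by (auto simp: extends_prime_valuation_def)
  have inv: "?F i \<in> SL2_invariants d" if "i \<le> n" for i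
    using generators that generated_algebra.gen[of "?F i" "?F ` {..n}"]
    by (auto simp: minimal_homogeneous_generators_def)
  have hom: "homogeneous_of_degree (q i) (?F i)" if "i \<le> n" for i
    using generators that by (auto simp: minimal_homogeneous_generators_def)
  \<comment> \<open>Membership in \<open>SL2_invariants\<close> bounds the variables over the
    algebraic closure; the bound holds for \<open>\<xi> i\<close> too, since both have the same
    keys.\<close>
  have int: "algebraic_int (invariant_value (\<xi> i) f)" if "i \<le> n" for i
    using inv[OF that] form by (intro algebraic_int_invariant_value[of _ d])
      (auto simp: SL2_invariants_def)
  have "semistable v n \<xi> (\<lambda>i. to_ac (f i)) \<longleftrightarrow>
            \<not> (\<forall>i\<le>n. p divides\<^bsub>ring_of_integers\<^esub> invariant_value (\<xi> i) f)"
    using extends_prime_valuation_le_0_iff[OF p prime_p(2) valuation int]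
    by (auto simp: semistable_def to_ac_invariant_value)
  moreover have "invertible M \<and> semistable v n \<xi> (form_subst d M (\<lambda>i. to_ac (f i)))"
    if j: "j \<le> n" "invariant_value (\<xi> j) f \<noteq> 0"
      and \<alpha>: "prime_exponent p (invariant_value (\<xi> j) f) = \<alpha>"
      and r: "r = 2 * of_nat \<alpha> / (of_nat d * of_nat (q j))"
      and \<pi>: "is_rat_power r (to_ac p) \<pi>"
      and M: "M = vector [vector [1 / \<pi>, 0], vector [0, 1]]"
    for \<alpha> j and r :: rat and \<pi> and M :: "'k alg_closure ^ 2 ^ 2"
  proof
    note p' = ring_prime_ring_of_integersD[OF p prime_p(2)]
    have vp: "v (to_ac p) = ereal 1"
      using ext[OF p p'(1)] prime_exponent_self[OF p p'] by simp
    have "\<pi> \<noteq> 0" and v\<pi>: "v \<pi> = ereal (of_rat r)"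
      using is_valuation_rat_power[OF val vp _ \<pi>] p'(1) by auto
    thus "invertible M"
      by (simp add: M invertible_det_nz det_2)
    \<comment> \<open>Either square root will do, since only 2 v(s) = -v(\<pi>) matters.\<close>
    obtain s where s: "s ^ 2 = 1 / \<pi>"
      using nth_root_exists[of 2 "1 / \<pi>"] by auto
    hence "s \<noteq> 0"
      using \<open>\<pi> \<noteq> 0\<close> by auto
    then obtain t where t: "v s = ereal t"
      using is_valuation_finite[OF val] by blast
    have "2 * t = - of_rat r"
      using is_valuation_power[OF val t, of 2] is_valuation_inverse[OF val v\<pi> \<open>\<pi> \<noteq> 0\<close>] s
      by (simp add: inverse_eq_divide)
    moreover have "q j > 0"
      using minimal_homogeneous_generators_degree_pos[OF generators j(1)] .
    \<comment> \<open>Here 2 t = -r is multiplied by d q_j / 2, where d and q_j are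
      positive.\<close>
    ultimately have "real (d * q j) * t + real \<alpha> = 0"
      using r \<open>d \<ge> 2\<close> by (simp add: of_rat_divide of_rat_mult field_simps)
    moreover have "invariant_value (\<xi> j) (form_subst d M (\<lambda>i. to_ac (f i))) =
        s ^ (d * q j) * to_ac (invariant_value (\<xi> j) f)"
      using SL2_invariant_diagonal[OF inv[OF j(1)] hom[OF j(1)] \<open>s \<noteq> 0\<close>]
      unfolding to_ac_invariant_value[symmetric] by (simp add: M s invariant_value_def)
    ultimately have "v (invariant_value (\<xi> j) (form_subst d M (\<lambda>i. to_ac (f i)))) = 0"
      using ext[OF int[OF j(1)] j(2)] \<alpha> is_valuation_power[OF val t, of "d * q j"]
      by (simp add: is_valuation_mult[OF val] zero_ereal_def)
    thus "semistable v n \<xi> (form_subst d M (\<lambda>i. to_ac (f i)))"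
      using j(1) by (auto simp: semistable_def)
  qed
  ultimately show ?thesis by blast
qed

end
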